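(* Given correct static weight predictions, the following algorithm is a non-clairvoyant $4$-competitive algorithm for minimizing the total weighted completion time of jobs with online chain precedence constraints on a single machine: maintain $W_c(t)$ for each chain $c$, initialized to the given total weight $W_c$ of $c$; while unfinished jobs remain, at each time $t$ process the front job of every chain $c$ at rate $W_c(t)/\sum_{c'}W_{c'}(t)$ and, whenever a job $j$ of chain $c$ finishes, decrease $W_c$ by $w_j$; chains with remaining weight $0$ are processed at the end in arbitrary order.
   Context: Problem (non-clairvoyant single-machine scheduling with online precedence constraints): jobs with processing requirements $p_j\ge0$ (unknown to the algorithm) and weights $w_j\ge0$; the precedence graph is a collection $\mathcal C$ of disjoint chains (every job has at most one direct predecessor and one direct successor); a job is revealed, with its weight, only once its predecessor is completed, and only then may be processed. Time is discrete; a preemptive schedule assigns rates $R_j^t\ge0$ with $\sum_jR_j^t\le1$; $C_j$ is the first $t$ with $\sum_{t'\le t}R_j^{t'}\ge p_j$. Objective: minimize $\sum_jw_jC_j$, compared with the offline optimum $\mathrm{Opt}$; $\rho$-competitive means $\mathrm{Alg}\le\rho\,\mathrm{Opt}$ always. Static weight predictions for chains: at time $0$ the algorithm is given, for each chain $c\in\mathcal C$, a value which (being correct) equals the total weight $W_c=\sum_{j\in c}w_j$ of the chain. *)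

theory Defs
  imports Complex_Main
begin

record ('j, 'c) sched_instance =
  jobs :: "'j set"
  prec :: "('j \<times> 'j) set"
  proc :: "'j \<Rightarrow> real"
  weight :: "'j \<Rightarrow> real"
  chain_of :: "'j \<Rightarrow> 'c"

definition chains :: "('j, 'c) sched_instance \<Rightarrow> 'c set" where
  "chains I = chain_of I ` jobs I"

definition chain_weight :: "('j, 'c) sched_instance \<Rightarrow> 'c \<Rightarrow> real" where
  "chain_weight I c = (\<Sum>j\<in>{j \<in> jobs I. chain_of I j = c}. weight I j)"

text \<open>
  \<^term>\<open>prec I\<close> contains the pairs (direct predecessor, direct successor).  The chains are its
  connected components; \<^term>\<open>chain_of I\<close> only gives them names.
\<close>
definition chain_instance :: "('j, 'c) sched_instance \<Rightarrow> bool" where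
  "chain_instance I \<longleftrightarrow>
     finite (jobs I) \<and>
     (\<forall>j\<in>jobs I. 0 \<le> proc I j) \<and>
     (\<forall>j\<in>jobs I. 0 \<le> weight I j) \<and>
     prec I \<subseteq> jobs I \<times> jobs I \<and>
     acyclic (prec I) \<and>
     single_valued (prec I) \<and>
     single_valued ((prec I)\<inverse>) \<and>
     (\<forall>j\<in>jobs I. \<forall>k\<in>jobs I.
        chain_of I j = chain_of I k \<longleftrightarrow> (j, k) \<in> (prec I \<union> (prec I)\<inverse>)\<^sup>*)"

text \<open>
  A schedule \<open>R\<close> gives the rate \<open>R t j\<close> of job \<open>j\<close> in time slot \<open>t = 1, 2, \<dots>\<close>.  Slot \<open>t\<close> is the unit
  interval from \<open>t - 1\<close> to \<open>t\<close>, so a job finished in slot \<open>t\<close> has completion time \<open>t\<close>; the value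
  \<open>R 0\<close> is never used.
\<close>
type_synonym 'j schedule = "nat \<Rightarrow> 'j \<Rightarrow> real"

definition work :: "'j schedule \<Rightarrow> 'j \<Rightarrow> nat \<Rightarrow> real" where
  "work R j t = (\<Sum>s=1..t. R s j)"

definition released :: "('j, 'c) sched_instance \<Rightarrow> 'j set \<Rightarrow> 'j set" where
  "released I D = {j \<in> jobs I. \<forall>i. (i, j) \<in> prec I \<longrightarrow> i \<in> D}"

text \<open>
  The jobs completed at the end of slot \<open>t\<close>.  The restriction to released jobs matters only for jobs
  with processing requirement 0, which otherwise would be completed before their predecessors;
  see \<open>completed_iff_work\<close> below.
\<close>
primrec completed :: "('j, 'c) sched_instance \<Rightarrow> 'j schedule \<Rightarrow> nat \<Rightarrow> 'j set" where
  "completed I R 0 = {}"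
| "completed I R (Suc t) = completed I R t \<union>
     {j \<in> released I (completed I R t). proc I j \<le> work R j (Suc t)}"

definition feasible :: "('j, 'c) sched_instance \<Rightarrow> 'j schedule \<Rightarrow> bool" where
  "feasible I R \<longleftrightarrow>
     (\<forall>t. (\<forall>j\<in>jobs I. 0 \<le> R (Suc t) j) \<and>
          (\<Sum>j\<in>jobs I. R (Suc t) j) \<le> 1 \<and>
          (\<forall>j\<in>jobs I. 0 < R (Suc t) j \<longrightarrow> j \<in> released I (completed I R t)))"

definition completes_all :: "('j, 'c) sched_instance \<Rightarrow> 'j schedule \<Rightarrow> bool" where
  "completes_all I R \<longleftrightarrow> (\<forall>j\<in>jobs I. \<exists>t. j \<in> completed I R t)"

definition completion_time :: "('j, 'c) sched_instance \<Rightarrow> 'j schedule \<Rightarrow> 'j \<Rightarrow> nat" where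
  "completion_time I R j = (LEAST t. j \<in> completed I R t)"

definition cost :: "('j, 'c) sched_instance \<Rightarrow> 'j schedule \<Rightarrow> real" where
  "cost I R = (\<Sum>j\<in>jobs I. weight I j * real (completion_time I R j))"

definition opt :: "('j, 'c) sched_instance \<Rightarrow> real" where
  "opt I = Inf {cost I R | R. feasible I R \<and> completes_all I R}"

lemma completed_mono: "s \<le> t \<Longrightarrow> completed I R s \<subseteq> completed I R t"
  by (induction t) (auto simp: le_Suc_eq)

lemma completed_iff_work:
  assumes "feasible I R" "j \<in> jobs I" "0 < proc I j"
  shows "j \<in> completed I R t \<longleftrightarrow> proc I j \<le> work R j t"
proof (induction t)
  case 0
  then show ?case using assms(3) by (simp add: work_def)
next
  case (Suc t)
  have step: "work R j (Suc t) = work R j t + R (Suc t) j"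
    by (simp add: work_def)
  have nonneg: "0 \<le> R (Suc t) j"
    and rel: "0 < R (Suc t) j \<Longrightarrow> j \<in> released I (completed I R t)"
    using assms(1,2) by (auto simp: feasible_def)
  show ?case
    using Suc step nonneg rel by (cases "R (Suc t) j = 0") auto
qed

text \<open>
  What a non-clairvoyant algorithm observes at the end of a slot: the jobs revealed so far, each
  with its chain and its weight, and which of them are completed.  Processing requirements and
  unrevealed jobs are not part of it.
\<close>
record ('j, 'c) view =
  seen :: "'j \<Rightarrow> ('c \<times> real) option"
  finished :: "'j set"

definition view_at :: "('j, 'c) sched_instance \<Rightarrow> 'j schedule \<Rightarrow> nat \<Rightarrow> ('j, 'c) view" where
  "view_at I R t =
     \<lparr> seen = (\<lambda>j. if j \<in> released I (completed I R t)
                    then Some (chain_of I j, weight I j) else None),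
       finished = completed I R t \<rparr>"

text \<open>
  An online algorithm determines the rates of the next slot from the static weight predictions
  (one for every chain) and from the views at times \<open>0, \<dots>, t\<close>.  Being a function of these
  arguments only, it is non-clairvoyant.
\<close>
type_synonym ('j, 'c) online_algorithm =
  "('c \<Rightarrow> real option) \<Rightarrow> ('j, 'c) view list \<Rightarrow> 'j \<Rightarrow> real"

definition correct_predictions :: "('j, 'c) sched_instance \<Rightarrow> 'c \<Rightarrow> real option" where
  "correct_predictions I = (\<lambda>c. if c \<in> chains I then Some (chain_weight I c) else None)"

primrec run_prefix ::
  "('j, 'c) online_algorithm \<Rightarrow> ('j, 'c) sched_instance \<Rightarrow> nat \<Rightarrow> 'j schedule" where
  "run_prefix A I 0 = (\<lambda>_ _. 0)"
| "run_prefix A I (Suc t) = (run_prefix A I t)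
     (Suc t := A (correct_predictions I) (map (view_at I (run_prefix A I t)) [0..<Suc t]))"

definition run :: "('j, 'c) online_algorithm \<Rightarrow> ('j, 'c) sched_instance \<Rightarrow> 'j schedule" where
  "run A I t = run_prefix A I t t"

definition competitive :: "real \<Rightarrow> ('j, 'c) online_algorithm \<Rightarrow> bool" where
  "competitive \<rho> A \<longleftrightarrow>
     (\<forall>I. chain_instance I \<longrightarrow>
        feasible I (run A I) \<and> completes_all I (run A I) \<and> cost I (run A I) \<le> \<rho> * opt I)"

definition front :: "('j, 'c) view \<Rightarrow> 'j set" where
  "front V = dom (seen V) - finished V"

definition view_chain :: "('j, 'c) view \<Rightarrow> 'j \<Rightarrow> 'c" where
  "view_chain V j = fst (the (seen V j))"

definition view_weight :: "('j, 'c) view \<Rightarrow> 'j \<Rightarrow> real" where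
  "view_weight V j = snd (the (seen V j))"

definition remaining_weight :: "('c \<Rightarrow> real option) \<Rightarrow> ('j, 'c) view \<Rightarrow> 'c \<Rightarrow> real" where
  "remaining_weight P V c =
     the (P c) - (\<Sum>j\<in>{j \<in> finished V. view_chain V j = c}. view_weight V j)"

text \<open>
  Once the total remaining weight is 0, \<open>pick\<close> selects one of the unfinished chains.  The selection
  depends only on the set of unfinished chains, so it does not change before the selected chain is
  finished: the chains are processed one after the other.
\<close>
definition weighted_chain_sharing :: "('c set \<Rightarrow> 'c) \<Rightarrow> ('j, 'c) online_algorithm" where
  "weighted_chain_sharing pick P H j =
     (let V = last H;
          total = (\<Sum>c\<in>dom P. remaining_weight P V c)
      in if j \<notin> front V then 0
         else if 0 < total then remaining_weight P V (view_chain V j) / total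
         else if view_chain V j = pick (view_chain V ` front V) then 1 else 0)"

end

theory Submission
  imports Defs
begin

text \<open>
  Let \<open>C\<^sub>j\<close> and \<open>D\<^sub>j\<close> be the completion times in the algorithm's schedule and in a competing
  schedule \<open>R\<close>, and let \<open>W t\<close> be the weight that the algorithm has not finished after slot \<open>t\<close>, so
  that its cost is the sum of all \<open>W t\<close>.  Compare the algorithm at time \<open>2 * t\<close> with \<open>R\<close> at time \<open>t\<close>:
  put \<open>f\<^sub>j = max 0 (C\<^sub>j - 2 * D\<^sub>j)\<close>.  By summation by parts along each chain, the sum of \<open>w\<^sub>j * f\<^sub>j\<close> equals
  the sum of \<open>u\<^sub>j * (f\<^sub>j - f\<^sub>i)\<close>, where \<open>i\<close> is the predecessor of \<open>j\<close> and \<open>u\<^sub>j\<close> the weight of \<open>j\<close> and all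
  its successors.  If \<open>f\<close> increases at \<open>j\<close>, then the algorithm spends at least \<open>f\<^sub>j - f\<^sub>i\<close> slots
  after time \<open>2 * D\<^sub>j - 1\<close> on the unfinished job \<open>j\<close>, each at rate at least \<open>u\<^sub>j / W (2 * D\<^sub>j - 1)\<close>;
  hence \<open>u\<^sub>j * (f\<^sub>j - f\<^sub>i) \<le> p\<^sub>j * W (2 * D\<^sub>j - 1)\<close>.  Charging this to the work of \<open>R\<close> on \<open>j\<close>, which has unit
  capacity per slot, bounds the total by the sum of the \<open>W (2 * t - 1)\<close>, that is, by half of the
  algorithm's cost \<open>A\<close>.  So \<open>A \<le> 2 * cost R + A / 2\<close>.
\<close>

section \<open>Schedules\<close>

lemma work_Suc: "work R j (Suc t) = work R j t + R (Suc t) j"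
  by (simp add: work_def)

lemma work_nonneg:
  assumes "feasible I R" "j \<in> jobs I"
  shows "0 \<le> work R j t"
  using assms by (induction t) (auto simp: work_Suc feasible_def, simp add: work_def)

lemma completed_subset_jobs: "completed I R t \<subseteq> jobs I"
  by (induction t) (auto simp: released_def)

text \<open>A job enters \<open>completed\<close> only if it was released one slot earlier, so
  completion times increase strictly along a chain, even through jobs with processing requirement
  0.\<close>

lemma completed_Suc_imp_pred_completed:
  assumes "(i, j) \<in> prec I" "j \<in> completed I R (Suc t)"
  shows "i \<in> completed I R t"
  using assms
proof (induction t)
  case 0
  then show ?case by (auto simp: released_def)
next
  case (Suc t)
  show ?case
  proof (cases "j \<in> completed I R (Suc t)")
    case True
    then show ?thesis using Suc.IH[OF Suc.prems(1)] completed_mono[of t "Suc t" I R] by auto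
  next
    case False
    with Suc.prems(2) have "j \<in> released I (completed I R (Suc t))"
      by (subst (asm) completed.simps) blast
    then show ?thesis using Suc.prems(1) by (auto simp: released_def)
  qed
qed

lemma completed_imp_pred_completed:
  assumes "(i, j) \<in> prec I" "j \<in> completed I R t"
  shows "i \<in> completed I R t"
proof -
  have "j \<in> completed I R (Suc t)"
    using assms(2) by simp
  then show ?thesis by (rule completed_Suc_imp_pred_completed[OF assms(1)])
qed

lemma completed_imp_predecessors_completed:
  assumes "(i, j) \<in> (prec I)\<^sup>*" "j \<in> completed I R t"
  shows "i \<in> completed I R t"
  using assms by (induction rule: converse_rtrancl_induct) (auto intro: completed_imp_pred_completed)

lemma completed_subset_released: "completed I R t \<subseteq> released I (completed I R t)"
  using completed_subset_jobs[of I R t] completed_imp_pred_completed[of _ _ I R t]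
  unfolding released_def by blast

lemma completed_imp_proc_le_work:
  assumes "feasible I R" "j \<in> completed I R t"
  shows "proc I j \<le> work R j t"
  using assms(2)
proof (induction t)
  case (Suc t)
  have "0 \<le> R (Suc t) j"
    using assms(1) Suc.prems completed_subset_jobs[of I R "Suc t"] unfolding feasible_def by blast
  then show ?case using Suc by (auto simp: work_Suc)
qed simp

lemma mem_completed_iff:
  assumes "completes_all I R" "j \<in> jobs I"
  shows "j \<in> completed I R t \<longleftrightarrow> completion_time I R j \<le> t"
proof -
  have C: "j \<in> completed I R (completion_time I R j)"
    using assms unfolding completes_all_def completion_time_def by (metis (lifting) LeastI)
  show ?thesis
  proof
    show "completion_time I R j \<le> t" if "j \<in> completed I R t"
      using that unfolding completion_time_def by (rule Least_le)
    show "j \<in> completed I R t" if "completion_time I R j \<le> t"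
      using C completed_mono[OF that, of I R] by blast
  qed
qed

lemma completion_time_pos:
  assumes "completes_all I R" "j \<in> jobs I"
  shows "0 < completion_time I R j"
  using mem_completed_iff[OF assms, of 0] by auto

lemma completion_time_pred_less:
  assumes "completes_all I R" "(i, j) \<in> prec I" "i \<in> jobs I" "j \<in> jobs I"
  shows "completion_time I R i < completion_time I R j"
proof -
  obtain t where t: "completion_time I R j = Suc t"
    using completion_time_pos[OF assms(1,4)] gr0_implies_Suc by blast
  then have "j \<in> completed I R (Suc t)"
    using mem_completed_iff[OF assms(1,4), of "Suc t"] by (simp del: completed.simps)
  then have "i \<in> completed I R t"
    by (rule completed_Suc_imp_pred_completed[OF assms(2)])
  then show ?thesis using mem_completed_iff[OF assms(1,3)] t by simp
qed

section \<open>Causality of schedules and of online runs\<close>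

lemma completed_cong:
  assumes "\<And>s. s \<le> t \<Longrightarrow> R s = R' s"
  shows "completed I R t = completed I R' t"
  using assms
proof (induction t)
  case (Suc t)
  have "work R j (Suc t) = work R' j (Suc t)" for j
    using Suc.prems by (auto simp: work_def intro!: sum.cong)
  then show ?case using Suc by simp
qed simp

lemma run_prefix_eq_run: "s \<le> t \<Longrightarrow> run_prefix A I t s = run A I s"
  by (induction t) (auto simp: le_Suc_eq run_def)

text \<open>\<open>run\<close> is the diagonal of the prefixes, and a view at time \<open>s\<close>
  depends only on slots up to \<open>s\<close>; so the history can be read off the final
  schedule.\<close>

lemma run_Suc:
  "run A I (Suc t) = A (correct_predictions I) (map (view_at I (run A I)) [0..<Suc t])"
proof -
  have "completed I (run_prefix A I t) s = completed I (run A I) s" if "s \<le> t" for s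
    using that by (intro completed_cong run_prefix_eq_run) simp
  then have "view_at I (run_prefix A I t) s = view_at I (run A I) s" if "s < Suc t" for s
    using that by (simp add: view_at_def)
  then have *: "map (view_at I (run_prefix A I t)) [0..<Suc t] =
      map (view_at I (run A I)) [0..<Suc t]"
    by (intro map_cong) auto
  show ?thesis
    unfolding run_def[of A I "Suc t"] run_prefix.simps * by simp
qed

section \<open>Chains\<close>

text \<open>The \<open>u\<^sub>j\<close> of the overview: for the front job of a chain, the
  remaining weight of that chain.\<close>

definition weight_from :: "('j, 'c) sched_instance \<Rightarrow> 'j \<Rightarrow> real" where
  "weight_from I j = (\<Sum>k\<in>{k \<in> jobs I. (j, k) \<in> (prec I)\<^sup>*}. weight I k)"

definition unfinished_weight :: "('j, 'c) sched_instance \<Rightarrow> 'j schedule \<Rightarrow> nat \<Rightarrow> real" where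
  "unfinished_weight I R t = (\<Sum>j\<in>jobs I - completed I R t. weight I j)"

definition chain_unfinished_weight ::
  "('j, 'c) sched_instance \<Rightarrow> 'j schedule \<Rightarrow> nat \<Rightarrow> 'c \<Rightarrow> real" where
  "chain_unfinished_weight I R t c =
     (\<Sum>j\<in>{j \<in> jobs I - completed I R t. chain_of I j = c}. weight I j)"

locale chain_scheduling =
  fixes I :: "('j, 'c) sched_instance"
  assumes chain_instance: "chain_instance I"
begin

lemma finite_jobs: "finite (jobs I)"
  and proc_nonneg: "j \<in> jobs I \<Longrightarrow> 0 \<le> proc I j"
  and weight_nonneg: "j \<in> jobs I \<Longrightarrow> 0 \<le> weight I j"
  and prec_subset: "prec I \<subseteq> jobs I \<times> jobs I"
  and acyclic_prec: "acyclic (prec I)"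
  and succ_unique: "(j, k) \<in> prec I \<Longrightarrow> (j, k') \<in> prec I \<Longrightarrow> k = k'"
  and pred_unique: "(i, j) \<in> prec I \<Longrightarrow> (i', j) \<in> prec I \<Longrightarrow> i = i'"
  and same_chain_iff: "j \<in> jobs I \<Longrightarrow> k \<in> jobs I \<Longrightarrow>
        chain_of I j = chain_of I k \<longleftrightarrow> (j, k) \<in> (prec I \<union> (prec I)\<inverse>)\<^sup>*"
  using chain_instance unfolding chain_instance_def single_valued_def by (blast+)

lemma wf_prec: "wf (prec I)"
  using finite_subset[OF prec_subset] finite_jobs acyclic_prec by (simp add: finite_acyclic_wf)

text \<open>Induct along the undirected path: since predecessors and successors are unique, each
  further edge prolongs the directed path or undoes its last step.\<close>

lemma same_chain_comparable:
  assumes "j \<in> jobs I" "k \<in> jobs I" "chain_of I j = chain_of I k"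
  shows "(j, k) \<in> (prec I)\<^sup>* \<or> (k, j) \<in> (prec I)\<^sup>*"
proof -
  have "(j, k) \<in> (prec I \<union> (prec I)\<inverse>)\<^sup>*"
    using assms same_chain_iff by blast
  then show ?thesis
  proof (induction rule: rtrancl_induct)
    case base
    then show ?case by simp
  next
    case (step y z)
    from step.IH show ?case
    proof
      assume jy: "(j, y) \<in> (prec I)\<^sup>*"
      show ?thesis
      proof (cases "(y, z) \<in> prec I")
        case True
        then show ?thesis using jy by (meson rtrancl.rtrancl_into_rtrancl)
      next
        case False
        then have "(z, y) \<in> prec I" using step.hyps by blast
        with jy show ?thesis
          by (metis pred_unique r_into_rtrancl rtrancl.cases)
      qed
    next
      assume yj: "(y, j) \<in> (prec I)\<^sup>*"
      show ?thesis
      proof (cases "(z, y) \<in> prec I")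
        case True
        then show ?thesis using yj by (meson converse_rtrancl_into_rtrancl)
      next
        case False
        then have "(y, z) \<in> prec I" using step.hyps by blast
        with yj show ?thesis
          by (metis succ_unique r_into_rtrancl converse_rtranclE)
      qed
    qed
  qed
qed

lemma successor_same_chain:
  assumes "(j, k) \<in> (prec I)\<^sup>*" "j \<in> jobs I"
  shows "k \<in> jobs I" "chain_of I k = chain_of I j"
proof -
  show k: "k \<in> jobs I"
    using assms prec_subset by (induction rule: rtrancl_induct) auto
  have "(j, k) \<in> (prec I \<union> (prec I)\<inverse>)\<^sup>*"
    using assms(1) rtrancl_mono[of "prec I" "prec I \<union> (prec I)\<inverse>"] by blast
  then show "chain_of I k = chain_of I j"
    using same_chain_iff[OF assms(2) k] by simp
qed

section \<open>Front jobs and the remaining weight of their chains\<close>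

lemma released_imp_strict_predecessors_completed:
  assumes "(j, k) \<in> (prec I)\<^sup>*" "j \<noteq> k" "k \<in> released I (completed I R t)"
  shows "j \<in> completed I R t"
proof -
  obtain i where "(j, i) \<in> (prec I)\<^sup>*" "(i, k) \<in> prec I"
    using assms(1,2) by (metis rtrancl.cases)
  then show ?thesis
    using assms(3) completed_imp_predecessors_completed[of j i I R t] by (auto simp: released_def)
qed

lemma front_unique:
  assumes "j \<in> released I (completed I R t) - completed I R t"
    and "k \<in> released I (completed I R t) - completed I R t"
    and "chain_of I j = chain_of I k"
  shows "j = k"
proof (rule ccontr)
  assume "j \<noteq> k"
  have "j \<in> jobs I" "k \<in> jobs I"
    using assms by (auto simp: released_def)
  from same_chain_comparable[OF this assms(3)] show False
    using \<open>j \<noteq> k\<close> assms released_imp_strict_predecessors_completed[of j k R t]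
      released_imp_strict_predecessors_completed[of k j R t] by auto
qed

text \<open>Take a \<open>prec\<close>-minimal unfinished job of the chain; its predecessor, if any,
  lies in the same chain and so is completed.\<close>

lemma front_exists:
  assumes "k \<in> jobs I - completed I R t"
  obtains j where "j \<in> released I (completed I R t) - completed I R t"
    and "chain_of I j = chain_of I k"
proof -
  let ?Q = "{j \<in> jobs I - completed I R t. chain_of I j = chain_of I k}"
  have "k \<in> ?Q" using assms by simp
  then obtain j where j: "j \<in> ?Q" "\<And>i. (i, j) \<in> prec I \<Longrightarrow> i \<notin> ?Q"
    by (rule wfE_min[OF wf_prec]) blast
  have "i \<in> completed I R t" if "(i, j) \<in> prec I" for i
  proof -
    have "i \<in> jobs I" using that prec_subset by auto
    then show ?thesis
      using successor_same_chain(2)[of i j] r_into_rtrancl[OF that] that j by auto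
  qed
  then show thesis using that[of j] j(1) by (auto simp: released_def)
qed

text \<open>When \<open>j\<close> is released, all earlier jobs of its chain are completed; while
  \<open>j\<close> is unfinished, so are its successors. This turns the weight used by the algorithm
  into one attached to a job.\<close>

lemma chain_unfinished_weight_front:
  assumes "j \<in> released I (completed I R t) - completed I R t"
  shows "chain_unfinished_weight I R t (chain_of I j) = weight_from I j"
proof -
  have j: "j \<in> jobs I" using assms by (auto simp: released_def)
  have "{k \<in> jobs I - completed I R t. chain_of I k = chain_of I j} =
        {k \<in> jobs I. (j, k) \<in> (prec I)\<^sup>*}" (is "?L = ?R")
  proof
    show "?L \<subseteq> ?R"
      using same_chain_comparable[OF j] assms
        released_imp_strict_predecessors_completed[of _ j R t] by fastforce
    show "?R \<subseteq> ?L"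
      using completed_imp_predecessors_completed[of j _ I R t] assms
        successor_same_chain(2)[OF _ j] by blast
  qed
  then show ?thesis by (simp add: chain_unfinished_weight_def weight_from_def)
qed

section \<open>Unfinished weight, cost and summation by parts\<close>

lemma chain_unfinished_weight_nonneg: "0 \<le> chain_unfinished_weight I R t c"
  unfolding chain_unfinished_weight_def by (intro sum_nonneg) (auto simp: weight_nonneg)

lemma sum_chain_unfinished_weight:
  "(\<Sum>c\<in>chains I. chain_unfinished_weight I R t c) = unfinished_weight I R t"
  unfolding chain_unfinished_weight_def unfinished_weight_def
  by (intro sum.group) (auto simp: finite_jobs chains_def)

lemma unfinished_weight_nonneg: "0 \<le> unfinished_weight I R t"
  unfolding unfinished_weight_def by (intro sum_nonneg) (auto simp: weight_nonneg)

lemma unfinished_weight_antimono: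
  assumes "s \<le> t"
  shows "unfinished_weight I R t \<le> unfinished_weight I R s"
  unfolding unfinished_weight_def using completed_mono[OF assms, of I R]
  by (intro sum_mono2) (auto simp: finite_jobs weight_nonneg)

lemma weight_from_nonneg: "0 \<le> weight_from I j"
  unfolding weight_from_def by (intro sum_nonneg) (auto simp: weight_nonneg)

lemma weight_from_le_unfinished_weight:
  assumes "j \<notin> completed I R t"
  shows "weight_from I j \<le> unfinished_weight I R t"
  unfolding weight_from_def unfinished_weight_def
  using assms completed_imp_predecessors_completed[of j _ I R t]
  by (intro sum_mono2) (auto simp: finite_jobs weight_nonneg)

text \<open>Double counting: \<open>weight I j\<close> is counted once for each time
  \<open>t < completion_time I R j\<close>.\<close>

lemma cost_eq_sum_unfinished_weight:
  assumes "completes_all I R" "\<And>j. j \<in> jobs I \<Longrightarrow> completion_time I R j \<le> N"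
  shows "cost I R = (\<Sum>t<N. unfinished_weight I R t)"
proof -
  have "(\<Sum>t<N. unfinished_weight I R t) =
      (\<Sum>t<N. \<Sum>j\<in>jobs I. if t < completion_time I R j then weight I j else 0)"
    unfolding unfinished_weight_def
  proof (rule sum.cong[OF refl])
    fix t
    have "jobs I - completed I R t = {j \<in> jobs I. t < completion_time I R j}"
      using mem_completed_iff[OF assms(1)] by (auto simp: not_le)
    then show "sum (weight I) (jobs I - completed I R t) =
        (\<Sum>j\<in>jobs I. if t < completion_time I R j then weight I j else 0)"
      by (simp add: sum.inter_filter finite_jobs)
  qed
  also have "\<dots> = (\<Sum>j\<in>jobs I. \<Sum>t<N. if t < completion_time I R j then weight I j else 0)"
    by (rule sum.swap)
  also have "\<dots> = cost I R"
    unfolding cost_def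
  proof (rule sum.cong[OF refl])
    fix j assume "j \<in> jobs I"
    then have "{t \<in> {..<N}. t < completion_time I R j} = {..<completion_time I R j}"
      using assms(2) by fastforce
    then show "(\<Sum>t<N. if t < completion_time I R j then weight I j else 0) =
        weight I j * real (completion_time I R j)"
      by (simp flip: sum.inter_filter)
  qed
  finally show ?thesis by simp
qed

text \<open>Summation by parts: \<open>f\<close> sums its increments \<open>g\<close> over an
  initial segment of the chain; exchanging the sums collects, for each increment, the weights of
  that job and its successors.\<close>

lemma sum_weight_eq_sum_weight_from:
  fixes f g :: "'j \<Rightarrow> real"
  assumes head: "\<And>j. j \<in> jobs I \<Longrightarrow> (\<forall>i. (i, j) \<notin> prec I) \<Longrightarrow> f j = g j"
    and step: "\<And>i j. (i, j) \<in> prec I \<Longrightarrow> f j = f i + g j"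
  shows "(\<Sum>j\<in>jobs I. weight I j * f j) = (\<Sum>j\<in>jobs I. weight_from I j * g j)"
proof -
  have f: "j \<in> jobs I \<Longrightarrow> f j = (\<Sum>i\<in>{i \<in> jobs I. (i, j) \<in> (prec I)\<^sup>*}. g i)" for j
  proof (induction j rule: wf_induct_rule[OF wf_prec])
    case (1 j)
    show ?case
    proof (cases "\<exists>i. (i, j) \<in> prec I")
      case False
      then have "{i \<in> jobs I. (i, j) \<in> (prec I)\<^sup>*} = {j}"
        using "1.prems" by (auto elim: rtranclE)
      then show ?thesis using head[OF "1.prems"] False by simp
    next
      case True
      then obtain i where i: "(i, j) \<in> prec I" by blast
      then have iI: "i \<in> jobs I" using prec_subset by auto
      \<comment> \<open>Predecessors are unique, so every job strictly before \<open>j\<close>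
        equals or precedes \<open>i\<close>.\<close>
      have "{k \<in> jobs I. (k, j) \<in> (prec I)\<^sup>*} = insert j {k \<in> jobs I. (k, i) \<in> (prec I)\<^sup>*}"
        using i "1.prems" by (auto elim: rtranclE dest: pred_unique[OF i] intro: rtrancl_into_rtrancl)
      moreover have "(j, i) \<notin> (prec I)\<^sup>*"
        using i acyclic_prec by (meson acyclic_def rtrancl_into_trancl1)
      ultimately show ?thesis
        using step[OF i] "1.IH"[OF i iI] finite_jobs by simp
    qed
  qed
  have "(\<Sum>j\<in>jobs I. weight I j * f j) =
      (\<Sum>j\<in>jobs I. \<Sum>i\<in>jobs I. if (i, j) \<in> (prec I)\<^sup>* then weight I j * g i else 0)"
    using finite_jobs by (intro sum.cong refl) (simp add: f sum_distrib_left flip: sum.inter_filter)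
  also have "\<dots> = (\<Sum>i\<in>jobs I. \<Sum>j\<in>jobs I. if (i, j) \<in> (prec I)\<^sup>* then weight I j * g i else 0)"
    by (rule sum.swap)
  also have "\<dots> = (\<Sum>i\<in>jobs I. weight_from I i * g i)"
    using finite_jobs
    by (intro sum.cong refl) (simp add: weight_from_def sum_distrib_right flip: sum.inter_filter)
  finally show ?thesis .
qed

section \<open>Comparison with an arbitrary schedule\<close>

text \<open>In the application \<open>a\<close> and \<open>b\<close> are the completion times of the
  predecessor of \<open>j\<close> in \<open>S\<close> and in the competing schedule (both 0 for a
  chain head), and \<open>c\<close> is that of \<open>j\<close> in the competing schedule. The
  bracket is then the increment \<open>f\<^sub>j - f\<^sub>i\<close> of the overview.\<close>

lemma delay_increment_le:
  fixes a b c :: nat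
  assumes S: "feasible I S" "completes_all I S"
    and rate: "\<And>t. 0 < unfinished_weight I S t \<Longrightarrow> j \<in> released I (completed I S t) \<Longrightarrow>
      j \<notin> completed I S t \<Longrightarrow> S (Suc t) j = weight_from I j / unfinished_weight I S t"
    and j: "j \<in> jobs I" "j \<in> released I (completed I S a)" and "b < c"
  shows "weight_from I j *
      (max 0 (real (completion_time I S j) - 2 * real c) - max 0 (real a - 2 * real b))
    \<le> proc I j * unfinished_weight I S (2 * c - 1)"
proof -
  define C where "C = completion_time I S j"
  define W where "W = unfinished_weight I S"
  define u where "u = weight_from I j"
  define d where "d = max 0 (real C - 2 * real c) - max 0 (real a - 2 * real b)"
  \<comment> \<open>The slots \<open>l + 1, \<dots>, C - 1\<close> number at least \<open>d\<close>; in each of them \<open>j\<close> is processed but not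
    finished, so that no work is wasted.\<close>
  define l where "l = max (2 * c - 1) (a + 1)"
  have rhs: "0 \<le> proc I j * W (2 * c - 1)"
    using proc_nonneg[OF j(1)] by (simp add: W_def unfinished_weight_nonneg)
  have "u * d \<le> proc I j * W (2 * c - 1)"
  proof (cases "0 < u \<and> l < C - 1")
    case False
    have "d \<le> 0" if "C - 1 \<le> l"
      using that \<open>b < c\<close> unfolding d_def l_def by (auto simp: max_def split: if_splits)
    then have "u * d \<le> 0"
      using False weight_from_nonneg[of j] by (auto simp: u_def mult_nonneg_nonpos not_less)
    then show ?thesis using rhs by linarith
  next
    case True
    then have u: "0 < u" and lC: "l < C - 1" by auto
    \<comment> \<open>If \<open>l = 2 * c - 1\<close>, the bound is \<open>C - 2 * c\<close>.
      Otherwise it is \<open>C - a - 2\<close>, and \<open>b < c\<close> gives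
      \<open>2 * (c - b) \<ge> 2\<close>.\<close>
    have d: "d \<le> real (C - 1 - l)"
      using lC \<open>b < c\<close> unfolding d_def l_def by (auto simp: max_def split: if_splits)
    have open_iff: "j \<in> completed I S t \<longleftrightarrow> C \<le> t" for t
      using mem_completed_iff[OF S(2) j(1)] by (simp add: C_def)
    have rel: "j \<in> released I (completed I S t)" if "a \<le> t" for t
      using j(2) completed_mono[OF that, of I S] by (auto simp: released_def)
    have Wpos: "0 < W t" if "t < C" for t
      using weight_from_le_unfinished_weight[of j S t] open_iff[of t] that u
      by (simp add: W_def u_def)
    have Wl: "0 < W l" using Wpos lC by simp
    have "real (C - 1 - l) * (u / W l) = (\<Sum>t\<in>{l..<C - 1}. u / W l)"
      by simp
    also have "\<dots> \<le> (\<Sum>t\<in>{l..<C - 1}. S (Suc t) j)"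
    proof (rule sum_mono)
      fix t assume t: "t \<in> {l..<C - 1}"
      then have "S (Suc t) j = u / W t"
        using rate[of t] Wpos[of t] rel[of t] open_iff[of t] by (auto simp: W_def u_def l_def)
      moreover have "W t \<le> W l"
        using t by (simp add: W_def unfinished_weight_antimono)
      moreover have "0 < W t" using Wpos[of t] t by auto
      ultimately show "u / W l \<le> S (Suc t) j"
        using u by (simp add: frac_le)
    qed
    also have "\<dots> \<le> (\<Sum>t<C - 1. S (Suc t) j)"
      using S(1) j(1) by (intro sum_mono2) (auto simp: feasible_def)
    also have "\<dots> = work S j (C - 1)"
      unfolding work_def by (rule sum.reindex_bij_witness[of _ "\<lambda>s. s - 1" Suc]) auto
    \<comment> \<open>\<open>j\<close> is already released at \<open>C - 2\<close>; with more work
      than \<open>proc I j\<close> it would be completed at \<open>C - 1\<close>.\<close>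
    also have "\<dots> \<le> proc I j"
    proof (rule ccontr)
      assume "\<not> ?thesis"
      moreover have "C - 1 = Suc (C - 2)" "a \<le> C - 2"
        using lC by (auto simp: l_def)
      ultimately have "j \<in> completed I S (C - 1)"
        using rel[of "C - 2"] by simp
      then show False using open_iff lC by simp
    qed
    finally have "u * real (C - 1 - l) \<le> proc I j * W l"
      using Wl by (simp add: field_simps)
    moreover have "u * d \<le> u * real (C - 1 - l)"
      using d u by (intro mult_left_mono) auto
    moreover have "proc I j * W l \<le> proc I j * W (2 * c - 1)"
      using proc_nonneg[OF j(1)] unfolding W_def
      by (intro mult_left_mono unfinished_weight_antimono) (auto simp: l_def)
    ultimately show ?thesis by linarith
  qed
  then show ?thesis by (simp add: u_def d_def C_def W_def)
qed

text \<open>Apart from feasibility and completion, the argument of the overview uses only the rates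
  of front jobs while unfinished weight remains.\<close>

lemma proportional_sharing_cost_le:
  assumes S: "feasible I S" "completes_all I S"
    and rate: "\<And>t j. 0 < unfinished_weight I S t \<Longrightarrow> j \<in> released I (completed I S t) \<Longrightarrow>
      j \<notin> completed I S t \<Longrightarrow> S (Suc t) j = weight_from I j / unfinished_weight I S t"
    and R: "feasible I R" "completes_all I R"
  shows "cost I S \<le> 4 * cost I R"
proof -
  define C where "C = completion_time I S"
  define D where "D = completion_time I R"
  define W where "W = unfinished_weight I S"
  define f where "f j = max 0 (real (C j) - 2 * real (D j))" for j
  define pred where "pred j = (THE i. (i, j) \<in> prec I)" for j
  \<comment> \<open>A chain head counts its delay from 0, so its increment is \<open>f j\<close>
    itself.\<close>
  define g where "g j = f j - (if \<exists>i. (i, j) \<in> prec I then f (pred j) else 0)" for j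
  define N where "N = (\<Sum>j\<in>jobs I. C j + D j)"
  have pred: "pred j = i" if "(i, j) \<in> prec I" for i j
    using that pred_unique unfolding pred_def by blast
  have CDN: "C j + D j \<le> N" if "j \<in> jobs I" for j
    unfolding N_def by (rule member_le_sum) (auto simp: that finite_jobs)
  have W0: "0 \<le> W t" for t by (simp add: W_def unfinished_weight_nonneg)
  have Wanti: "W t \<le> W s" if "s \<le> t" for s t
    using that by (simp add: W_def unfinished_weight_antimono)
  have charge: "weight_from I j * g j \<le> (\<Sum>\<tau>=1..N. R \<tau> j * W (2 * \<tau> - 1))"
    if j: "j \<in> jobs I" for j
  proof -
    have R0: "0 \<le> R \<tau> j" if "1 \<le> \<tau>" for \<tau>
      using R(1) j that unfolding feasible_def by (metis Suc_le_D One_nat_def)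
    have "weight_from I j * g j \<le> proc I j * W (2 * D j - 1)"
    proof (cases "\<exists>i. (i, j) \<in> prec I")
      case False
      then have "j \<in> released I (completed I S 0)" using j by (auto simp: released_def)
      from delay_increment_le[OF S rate j this, of 0 "D j"] show ?thesis
        using completion_time_pos[OF R(2) j] False
        by (simp add: g_def f_def C_def D_def W_def)
    next
      case True
      then obtain i where i: "(i, j) \<in> prec I" by blast
      then have iI: "i \<in> jobs I" using prec_subset by auto
      have "j \<in> released I (completed I S (C i))"
        using j i pred_unique mem_completed_iff[OF S(2) iI] by (auto simp: released_def C_def)
      from delay_increment_le[OF S rate j this, of "D i" "D j"] show ?thesis
        using completion_time_pred_less[OF R(2) i iI j] True pred[OF i]
        by (simp add: g_def f_def C_def D_def W_def)
    qed
    also have "\<dots> \<le> work R j (D j) * W (2 * D j - 1)"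
      using completed_imp_proc_le_work[OF R(1)] mem_completed_iff[OF R(2) j] W0
      by (intro mult_right_mono) (auto simp: D_def)
    also have "\<dots> = (\<Sum>\<tau>=1..D j. R \<tau> j * W (2 * D j - 1))"
      by (simp add: work_def sum_distrib_right)
    \<comment> \<open>Work of \<open>R\<close> in slot \<open>\<tau> \<le> D j\<close> is charged at
      the earlier time \<open>2 * \<tau> - 1\<close>, when the unfinished weight is no
      smaller.\<close>
    also have "\<dots> \<le> (\<Sum>\<tau>=1..D j. R \<tau> j * W (2 * \<tau> - 1))"
      using R0 by (intro sum_mono mult_left_mono Wanti) auto
    also have "\<dots> \<le> (\<Sum>\<tau>=1..N. R \<tau> j * W (2 * \<tau> - 1))"
      using CDN[OF j] R0 W0 by (intro sum_mono2) auto
    finally show ?thesis .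
  qed
  \<comment> \<open>The horizon is even so that times can be paired below;
    \<open>C j + D j \<le> N\<close> makes it long enough.\<close>
  have cost_S: "cost I S = (\<Sum>t<2 * N. W t)"
    unfolding W_def using CDN by (intro cost_eq_sum_unfinished_weight[OF S(2)]) (fastforce simp: C_def)
  have "(\<Sum>j\<in>jobs I. weight I j * f j) = (\<Sum>j\<in>jobs I. weight_from I j * g j)"
    by (rule sum_weight_eq_sum_weight_from) (auto simp: g_def pred)
  also have "\<dots> \<le> (\<Sum>j\<in>jobs I. \<Sum>\<tau>=1..N. R \<tau> j * W (2 * \<tau> - 1))"
    by (rule sum_mono) (rule charge)
  also have "\<dots> = (\<Sum>\<tau>=1..N. (\<Sum>j\<in>jobs I. R \<tau> j) * W (2 * \<tau> - 1))"
    by (subst sum.swap) (simp add: sum_distrib_right)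
  also have "\<dots> \<le> (\<Sum>\<tau>=1..N. W (2 * \<tau> - 1))"
  proof (rule sum_mono)
    fix \<tau> assume "\<tau> \<in> {1..N}"
    then obtain t where "\<tau> = Suc t" by (cases \<tau>) auto
    then have "(\<Sum>j\<in>jobs I. R \<tau> j) \<le> 1" using R(1) by (auto simp: feasible_def)
    then show "(\<Sum>j\<in>jobs I. R \<tau> j) * W (2 * \<tau> - 1) \<le> W (2 * \<tau> - 1)"
      using mult_right_mono[OF _ W0, of _ 1] by simp
  qed
  \<comment> \<open>\<open>W\<close> never increases, so each odd term is at most the mean of itself
    and the even term before it.\<close>
  also have "\<dots> \<le> (\<Sum>t<2 * N. W t) / 2"
  proof (induction N)
    case (Suc n)
    then show ?case using Wanti[of "2 * n" "Suc (2 * n)"] by simp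
  qed simp
  finally have delay: "(\<Sum>j\<in>jobs I. weight I j * f j) \<le> cost I S / 2"
    by (simp add: cost_S)
  have "cost I S \<le> (\<Sum>j\<in>jobs I. weight I j * (2 * real (D j) + f j))"
    unfolding cost_def by (intro sum_mono mult_left_mono) (auto simp: f_def C_def weight_nonneg)
  also have "\<dots> = 2 * cost I R + (\<Sum>j\<in>jobs I. weight I j * f j)"
    by (simp add: cost_def D_def sum.distrib sum_distrib_left algebra_simps)
  finally show ?thesis using delay by simp
qed

section \<open>The algorithm\<close>

text \<open>Translates the view-based rule into quantities of the instance: the predictions are
  correct, so subtracting the weights of completed jobs leaves each chain's unfinished
  weight.\<close>

lemma weighted_chain_sharing_rate:
  fixes pick :: "'c set \<Rightarrow> 'c"
  defines "S \<equiv> run (weighted_chain_sharing pick) I"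
  defines "F \<equiv> \<lambda>t. released I (completed I S t) - completed I S t"
  shows "S (Suc t) j =
    (if j \<notin> F t then 0
     else if 0 < unfinished_weight I S t
       then chain_unfinished_weight I S t (chain_of I j) / unfinished_weight I S t
     else if chain_of I j = pick (chain_of I ` F t) then 1 else 0)"
proof -
  define V where "V = view_at I S t"
  define P where "P = correct_predictions I"
  have rate: "S (Suc t) j = weighted_chain_sharing pick P (map (view_at I S) [0..<Suc t]) j"
    by (simp only: S_def P_def run_Suc)
  have dom_P: "dom P = chains I"
    by (auto simp: P_def correct_predictions_def dom_def)
  have front: "front V = F t"
    by (auto simp: front_def V_def view_at_def F_def dom_def)
  have vc: "view_chain V k = chain_of I k" if "k \<in> released I (completed I S t)" for k
    using that by (simp add: view_chain_def V_def view_at_def)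
  have vw: "view_weight V k = weight I k" if "k \<in> released I (completed I S t)" for k
    using that by (simp add: view_weight_def V_def view_at_def)
  have rw: "remaining_weight P V c = chain_unfinished_weight I S t c" if "c \<in> chains I" for c
  proof -
    have fin: "finished V = completed I S t" by (simp add: V_def view_at_def)
    \<comment> \<open>Completed jobs stay released, so the view still shows their chains and
      weights.\<close>
    have "(\<Sum>k\<in>{k \<in> finished V. view_chain V k = c}. view_weight V k) =
        (\<Sum>k\<in>{k \<in> completed I S t. chain_of I k = c}. weight I k)"
      using completed_subset_released[of I S t] by (intro sum.cong) (auto simp: fin vc vw subset_iff)
    moreover have "{k \<in> jobs I - completed I S t. chain_of I k = c} =
        {k \<in> jobs I. chain_of I k = c} - {k \<in> completed I S t. chain_of I k = c}"
      by auto
    moreover have "{k \<in> completed I S t. chain_of I k = c} \<subseteq> {k \<in> jobs I. chain_of I k = c}"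
      using completed_subset_jobs[of I S t] by auto
    ultimately show ?thesis
      using that finite_jobs
      by (simp add: remaining_weight_def P_def correct_predictions_def chain_weight_def
          chain_unfinished_weight_def sum_diff)
  qed
  have total: "(\<Sum>c\<in>dom P. remaining_weight P V c) = unfinished_weight I S t"
    by (simp add: dom_P rw sum_chain_unfinished_weight)
  have vcF: "view_chain V k = chain_of I k" and chF: "chain_of I k \<in> chains I" if "k \<in> F t" for k
    using that vc by (auto simp: F_def released_def chains_def)
  then have "view_chain V ` F t = chain_of I ` F t" by auto
  moreover have "last (map (view_at I S) [0..<Suc t]) = V" by (simp add: V_def)
  ultimately show ?thesis
    unfolding rate weighted_chain_sharing_def Let_def by (simp add: total front vcF rw chF)
qed

text \<open>A chain has at most one front job, so sums over front jobs become sums over distinct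
  chains: the shares total at most 1, and \<open>pick\<close> selects at most one job.\<close>

lemma weighted_chain_sharing_feasible:
  fixes pick :: "'c set \<Rightarrow> 'c"
  shows "feasible I (run (weighted_chain_sharing pick) I)"
  unfolding feasible_def
proof (intro allI conjI)
  fix t
  define S where "S = run (weighted_chain_sharing pick) I"
  define F where "F = released I (completed I S t) - completed I S t"
  define W where "W = unfinished_weight I S t"
  have rate: "S (Suc t) j =
    (if j \<notin> F then 0
     else if 0 < W then chain_unfinished_weight I S t (chain_of I j) / W
     else if chain_of I j = pick (chain_of I ` F) then 1 else 0)" for j
    unfolding S_def F_def W_def by (rule weighted_chain_sharing_rate)
  have FI: "F \<subseteq> jobs I" by (auto simp: F_def released_def)
  have fin: "finite F" using FI finite_jobs finite_subset by blast
  have inj: "inj_on (chain_of I) F"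
    using front_unique unfolding F_def by (intro inj_onI)
  show "\<forall>j\<in>jobs I. 0 \<le> run (weighted_chain_sharing pick) I (Suc t) j"
    unfolding S_def[symmetric] rate by (simp add: chain_unfinished_weight_nonneg)
  show "\<forall>j\<in>jobs I. 0 < run (weighted_chain_sharing pick) I (Suc t) j \<longrightarrow>
      j \<in> released I (completed I (run (weighted_chain_sharing pick) I) t)"
    unfolding S_def[symmetric] rate by (simp add: F_def)
  have "(\<Sum>j\<in>jobs I. S (Suc t) j) = (\<Sum>j\<in>F. S (Suc t) j)"
    using FI finite_jobs by (intro sum.mono_neutral_right) (auto simp: rate)
  also have "\<dots> \<le> 1"
  proof (cases "0 < W")
    case True
    then have "(\<Sum>j\<in>F. S (Suc t) j) =
        (\<Sum>j\<in>F. chain_unfinished_weight I S t (chain_of I j)) / W"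
      by (simp add: rate sum_divide_distrib)
    also have "(\<Sum>j\<in>F. chain_unfinished_weight I S t (chain_of I j)) =
        (\<Sum>c\<in>chain_of I ` F. chain_unfinished_weight I S t c)"
      by (simp add: sum.reindex[OF inj])
    also have "\<dots> \<le> (\<Sum>c\<in>chains I. chain_unfinished_weight I S t c)"
      using FI finite_jobs
      by (intro sum_mono2) (auto simp: chains_def chain_unfinished_weight_nonneg)
    also have "\<dots> = W" by (simp add: sum_chain_unfinished_weight W_def)
    finally show ?thesis using True by (simp add: divide_right_mono)
  next
    case False
    then have "(\<Sum>j\<in>F. S (Suc t) j) =
        (\<Sum>j\<in>F. if chain_of I j = pick (chain_of I ` F) then 1 else 0)"
      by (simp add: rate)
    also have "\<dots> = (\<Sum>c\<in>chain_of I ` F. if c = pick (chain_of I ` F) then 1 else 0)"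
      by (simp add: sum.reindex[OF inj])
    also have "\<dots> \<le> 1" using fin by simp
    finally show ?thesis .
  qed
  finally show "(\<Sum>j\<in>jobs I. run (weighted_chain_sharing pick) I (Suc t) j) \<le> 1"
    by (simp add: S_def)
qed

text \<open>A positive total comes from some unfinished job of positive weight, and the front of its
  chain gets a positive share; otherwise the front of the picked chain gets rate 1.\<close>

lemma weighted_chain_sharing_progress:
  fixes pick :: "'c set \<Rightarrow> 'c"
  defines "S \<equiv> run (weighted_chain_sharing pick) I"
  assumes pick: "\<And>A. A \<noteq> {} \<Longrightarrow> pick A \<in> A"
    and unfinished: "k \<in> jobs I - completed I S t"
  obtains j where "j \<in> released I (completed I S t) - completed I S t" "0 < S (Suc t) j"
proof -
  define F where "F = released I (completed I S t) - completed I S t"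
  define W where "W = unfinished_weight I S t"
  have rate: "S (Suc t) j =
    (if j \<notin> F then 0
     else if 0 < W then chain_unfinished_weight I S t (chain_of I j) / W
     else if chain_of I j = pick (chain_of I ` F) then 1 else 0)" for j
    unfolding S_def F_def W_def by (rule weighted_chain_sharing_rate)
  show thesis
  proof (cases "0 < W")
    case True
    then obtain i where i: "i \<in> jobs I - completed I S t" "0 < weight I i"
      using sum_nonpos[of "jobs I - completed I S t" "weight I"]
      unfolding W_def unfinished_weight_def by force
    obtain j where j: "j \<in> F" "chain_of I j = chain_of I i"
      unfolding F_def by (rule front_exists[OF i(1)])
    have "weight I i \<le> chain_unfinished_weight I S t (chain_of I j)"
      unfolding chain_unfinished_weight_def
      using i j finite_jobs by (intro member_le_sum) (auto simp: weight_nonneg)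
    then have "0 < S (Suc t) j" using i j True by (simp add: rate)
    then show thesis using that j by (simp add: F_def)
  next
    case False
    have "F \<noteq> {}" using front_exists[OF unfinished] unfolding F_def by blast
    then have "pick (chain_of I ` F) \<in> chain_of I ` F" by (intro pick) simp
    then obtain j where j: "j \<in> F" "chain_of I j = pick (chain_of I ` F)" by auto
    then have "0 < S (Suc t) j" using False by (simp add: rate)
    then show thesis using that j by (simp add: F_def)
  qed
qed

lemma weighted_chain_sharing_completes_all:
  fixes pick :: "'c set \<Rightarrow> 'c"
  assumes pick: "\<And>A. A \<noteq> {} \<Longrightarrow> pick A \<in> A"
  shows "completes_all I (run (weighted_chain_sharing pick) I)"
proof (rule ccontr)
  define S where "S = run (weighted_chain_sharing pick) I"
  assume "\<not> completes_all I (run (weighted_chain_sharing pick) I)"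
  then obtain k where k: "k \<in> jobs I" "\<And>t. k \<notin> completed I S t"
    by (auto simp: completes_all_def S_def)
  \<comment> \<open>Once the set of completed jobs is stable, the rates are constant and one of them is positive.\<close>
  have "card (completed I S t) \<le> card (jobs I)" for t
    by (intro card_mono finite_jobs completed_subset_jobs)
  then have "\<forall>t. True \<longrightarrow> card (completed I S t) < Suc (card (jobs I))"
    by (simp add: less_Suc_eq_le)
  \<comment> \<open>The completed sets grow within a finite set, so one of maximal cardinality is
    final.\<close>
  then obtain T where T: "\<And>t. card (completed I S t) \<le> card (completed I S T)"
    using ex_has_greatest_nat[of "\<lambda>_. True" 0 "\<lambda>t. card (completed I S t)"] by blast
  have stable: "completed I S t = completed I S T" if "T \<le> t" for t
    using card_seteq[of "completed I S t" "completed I S T"] T[of t] completed_mono[OF that, of I S]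
      finite_subset[OF completed_subset_jobs finite_jobs] by auto
  obtain j where j: "j \<in> released I (completed I S T) - completed I S T" "0 < S (Suc T) j"
    using weighted_chain_sharing_progress[OF pick, of k T] k unfolding S_def by blast
  have const: "S (Suc t) j = S (Suc T) j" if "T \<le> t" for t
    using weighted_chain_sharing_rate[of pick t j] weighted_chain_sharing_rate[of pick T j]
      stable[OF that]
    by (simp add: S_def unfinished_weight_def chain_unfinished_weight_def)
  have work: "work S j (T + n) = work S j T + real n * S (Suc T) j" for n
  proof (induction n)
    case (Suc n)
    then show ?case using const[of "T + n"] by (simp add: work_Suc algebra_simps)
  qed simp
  \<comment> \<open>Linear growth of the work eventually exceeds \<open>proc I j\<close>, which
    would complete \<open>j\<close> after \<open>T\<close>.\<close>
  obtain n where n: "proc I j < real n * S (Suc T) j"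
    using reals_Archimedean3[OF j(2)] by blast
  have "0 \<le> work S j T"
    using weighted_chain_sharing_feasible j(1)
    by (intro work_nonneg[of I]) (auto simp: S_def released_def)
  then have "proc I j \<le> work S j (Suc (T + n))"
    using n work[of "Suc n"] j(2) by (simp add: algebra_simps)
  then have "j \<in> completed I S (Suc (T + n))"
    using j(1) stable[of "T + n"] by simp
  then show False using j(1) stable[of "Suc (T + n)"] by (simp del: completed.simps)
qed

end

theorem theorem5:
  fixes pick :: "'c set \<Rightarrow> 'c"
  assumes "\<And>S. S \<noteq> {} \<Longrightarrow> pick S \<in> S"
  shows "competitive 4 (weighted_chain_sharing pick :: ('j, 'c) online_algorithm)"
  unfolding competitive_def
proof (intro allI impI)
  fix I :: "('j, 'c) sched_instance"
  assume "chain_instance I"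
  then interpret chain_scheduling I by unfold_locales
  define S where "S = run (weighted_chain_sharing pick) I"
  have S: "feasible I S" "completes_all I S"
    unfolding S_def
    using weighted_chain_sharing_feasible weighted_chain_sharing_completes_all assms by blast+
  have rate: "S (Suc t) j = weight_from I j / unfinished_weight I S t"
    if "0 < unfinished_weight I S t" "j \<in> released I (completed I S t)" "j \<notin> completed I S t"
    for t j
    using that weighted_chain_sharing_rate[of pick t j] chain_unfinished_weight_front[of j S t]
    by (simp add: S_def)
  \<comment> \<open>\<open>opt I\<close> is an infimum, so every competing cost is bounded from
    below; the algorithm's own schedule shows that the set is nonempty.\<close>
  have "cost I S / 4 \<le> opt I"
    unfolding opt_def
  proof (rule cInf_greatest)
    show "{cost I R |R. feasible I R \<and> completes_all I R} \<noteq> {}" using S by blast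
    show "cost I S / 4 \<le> x" if "x \<in> {cost I R |R. feasible I R \<and> completes_all I R}" for x
      using that proportional_sharing_cost_le[OF S rate] by fastforce
  qed
  then show "feasible I (run (weighted_chain_sharing pick) I) \<and>
      completes_all I (run (weighted_chain_sharing pick) I) \<and>
      cost I (run (weighted_chain_sharing pick) I) \<le> 4 * opt I"
    using S by (simp add: S_def)
qed

end
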